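(* Let $m,n$ be integers with $n\ge3$ and $m-n\ge1$, and let $G$, $P$ and the matching $\mu:S\to P\setminus S$ be as in the context. Let $\sigma\in P$ and suppose there is an injective map $z=z_1z_2\cdots z_n$ (a vertex of $G$) with $\sigma\subseteq N(z)$ and $z_k=1$ for some $k\in[n]$. Let $\tau=\{f\in\sigma: f \text{ injective}\}$. Then $\sigma$ is a critical cell if and only if all of the following hold: (i) $X_\sigma=[m]$ or $X_\sigma=[m]\setminus\{1\}$; (ii) $\langle x\rangle\in\sigma$ for every $x\in[m]\setminus\{z_1,\dots,z_n\}$; (iii) for every $i\in[n]$, every $x\in X_i^\tau$ satisfies $x\ge z_i$; (iv) $X_r^\tau\cap X_s^\tau=\emptyset$ for all $r\ne s$ in $[n]$; (v) there exists $y\in X_k^\tau$ with $y<\min\{z_j: j\in[n],\ j\ne k\}$.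
   Context: $[k]=\{1,\dots,k\}$. Let $G$ be the graph whose vertices are the maps $f:[n]\to[m]$ that are either constant or injective, with $f\sim f'$ iff $f(i)\ne f'(j)$ for all $i\ne j$ in $[n]$ (injective maps have loops). The constant map with value $x$ is denoted $\langle x\rangle$; an injective map $f$ is written as the string $f(1)f(2)\cdots f(n)$. For a set $A$ of vertices, $N(A)$ is the set of common neighbours of $A$ (for a single vertex, its neighbours). The neighbourhood complex $\mathcal N(G)$ has as simplices the nonempty vertex sets with a common neighbour; $P$ is its set of simplices ordered by inclusion. For a set $\sigma$ of vertices, $X_i^\sigma=\{f(i):f\in\sigma\}$ and $X_\sigma=\bigcup_{i=1}^n X_i^\sigma$ (similarly $X_i^\tau$ for $\tau\subseteq\sigma$). Define $S_1=\{\sigma\in P:\langle 1\rangle\notin\sigma,\ \sigma\cup\{\langle1\rangle\}\in P\}$, $\mu_1(\sigma)=\sigma\cup\{\langle1\rangle\}$, $S_1'=P\setminus(S_1\cup\mu_1(S_1))$, and for $2\le i\le m$ inductively $S_i=\{\sigma\in S_{i-1}':\langle i\rangle\notin\sigma,\ \sigma\cup\{\langle i\rangle\}\in S'_{i-1}\}$, $\mu_i(\sigma)=\sigma\cup\{\langle i\rangle\}$, $S_i'=S_{i-1}'\setminus(S_i\cup\mu_i(S_i))$. Let $S=\bigcup_i S_i$ and $\mu(\sigma)=\mu_i(\sigma)$ for $\sigma\in S_i$. A simplex $\sigma\in P$ is critical if $\sigma\notin S\cup\mu(S)$. *)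

theory Defs
  imports "HOL-Library.FuncSet"
begin

(* Maps [n] -> [m] are encoded as extensional functions on {1..n}, so that equality of
   vertices is equality of maps on [n]. *)

definition const_map :: "nat \<Rightarrow> nat \<Rightarrow> nat \<Rightarrow> nat" where
  "const_map n x = (\<lambda>i\<in>{1..n}. x)"

definition inj_maps :: "nat \<Rightarrow> nat \<Rightarrow> (nat \<Rightarrow> nat) set" where
  "inj_maps n m = {f \<in> {1..n} \<rightarrow>\<^sub>E {1..m}. inj_on f {1..n}}"

definition verts :: "nat \<Rightarrow> nat \<Rightarrow> (nat \<Rightarrow> nat) set" where
  "verts n m = const_map n ` {1..m} \<union> inj_maps n m"

definition adj :: "nat \<Rightarrow> (nat \<Rightarrow> nat) \<Rightarrow> (nat \<Rightarrow> nat) \<Rightarrow> bool" where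
  "adj n f g \<longleftrightarrow> (\<forall>i\<in>{1..n}. \<forall>j\<in>{1..n}. i \<noteq> j \<longrightarrow> f i \<noteq> g j)"

definition common_nbrs :: "nat \<Rightarrow> nat \<Rightarrow> (nat \<Rightarrow> nat) set \<Rightarrow> (nat \<Rightarrow> nat) set" where
  "common_nbrs n m A = {g \<in> verts n m. \<forall>f\<in>A. adj n f g}"

definition nbhd_complex :: "nat \<Rightarrow> nat \<Rightarrow> (nat \<Rightarrow> nat) set set" where
  "nbhd_complex n m = {\<sigma>. \<sigma> \<noteq> {} \<and> \<sigma> \<subseteq> verts n m \<and> common_nbrs n m \<sigma> \<noteq> {}}"

definition X_at :: "nat \<Rightarrow> (nat \<Rightarrow> nat) set \<Rightarrow> nat set" where
  "X_at i \<sigma> = {f i |f. f \<in> \<sigma>}"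

definition X_all :: "nat \<Rightarrow> (nat \<Rightarrow> nat) set \<Rightarrow> nat set" where
  "X_all n \<sigma> = (\<Union>i\<in>{1..n}. X_at i \<sigma>)"

definition mu_step :: "nat \<Rightarrow> nat \<Rightarrow> (nat \<Rightarrow> nat) set \<Rightarrow> (nat \<Rightarrow> nat) set" where
  "mu_step n i \<sigma> = \<sigma> \<union> {const_map n i}"

definition S_step :: "nat \<Rightarrow> (nat \<Rightarrow> nat) set set \<Rightarrow> nat \<Rightarrow> (nat \<Rightarrow> nat) set set" where
  "S_step n Q i = {\<sigma> \<in> Q. const_map n i \<notin> \<sigma> \<and> \<sigma> \<union> {const_map n i} \<in> Q}"

(* S_rest n m i is S_i'; starting the recursion at S_0' = P makes the first step uniform
   with the others. *)

primrec S_rest :: "nat \<Rightarrow> nat \<Rightarrow> nat \<Rightarrow> (nat \<Rightarrow> nat) set set" where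
  "S_rest n m 0 = nbhd_complex n m"
| "S_rest n m (Suc i) = S_rest n m i -
     (S_step n (S_rest n m i) (Suc i) \<union> mu_step n (Suc i) ` S_step n (S_rest n m i) (Suc i))"

definition S_set :: "nat \<Rightarrow> nat \<Rightarrow> nat \<Rightarrow> (nat \<Rightarrow> nat) set set" where
  "S_set n m i = S_step n (S_rest n m (i - 1)) i"

definition S_all :: "nat \<Rightarrow> nat \<Rightarrow> (nat \<Rightarrow> nat) set set" where
  "S_all n m = (\<Union>i\<in>{1..m}. S_set n m i)"

definition mu :: "nat \<Rightarrow> nat \<Rightarrow> (nat \<Rightarrow> nat) set \<Rightarrow> (nat \<Rightarrow> nat) set" where
  "mu n m \<sigma> = mu_step n (THE i. i \<in> {1..m} \<and> \<sigma> \<in> S_set n m i) \<sigma>"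

definition critical :: "nat \<Rightarrow> nat \<Rightarrow> (nat \<Rightarrow> nat) set \<Rightarrow> bool" where
  "critical n m \<sigma> \<longleftrightarrow> \<sigma> \<in> nbhd_complex n m \<and> \<sigma> \<notin> S_all n m \<union> mu n m ` S_all n m"

(* The sets S_i are pairwise disjoint, so the description in the definition of mu is unique. *)

lemma S_rest_antimono: "i \<le> j \<Longrightarrow> S_rest n m j \<subseteq> S_rest n m i"
  by (induction j rule: dec_induct) auto

lemma S_set_disjoint:
  assumes "1 \<le> i" "i < j"
  shows "S_set n m i \<inter> S_set n m j = {}"
proof -
  from assms obtain i' where i: "i = Suc i'" by (cases i) auto
  have "S_set n m j \<subseteq> S_rest n m (j - 1)"
    by (auto simp: S_set_def S_step_def)
  also have "\<dots> \<subseteq> S_rest n m i"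
    using assms by (intro S_rest_antimono) simp
  finally show ?thesis
    by (auto simp: S_set_def i)
qed

lemma mu_eq:
  assumes "i \<in> {1..m}" "\<sigma> \<in> S_set n m i"
  shows "mu n m \<sigma> = mu_step n i \<sigma>"
proof -
  have "(THE j. j \<in> {1..m} \<and> \<sigma> \<in> S_set n m j) = i"
  proof (rule the_equality)
    show "i \<in> {1..m} \<and> \<sigma> \<in> S_set n m i" using assms by simp
    fix j assume j: "j \<in> {1..m} \<and> \<sigma> \<in> S_set n m j"
    show "j = i"
      using assms j S_set_disjoint[of i j n m] S_set_disjoint[of j i n m]
      by (cases i j rule: linorder_cases) auto
  qed
  then show ?thesis by (simp add: mu_def)
qed

end

theory Submission
  imports Defs
begin

text \<open>
  A set \<open>\<sigma>\<close> survives step \<open>i\<close> iff it survived step \<open>i - 1\<close> and the set obtained by toggling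
  \<open>\<langle>i\<rangle>\<close> did not. The injective part \<open>\<tau>\<close> is never changed, so one can fix \<open>\<tau>\<close> and follow the set
  \<open>U\<close> of those \<open>x\<close> with \<open>\<langle>x\<rangle> \<notin> \<sigma>\<close>, where \<open>1 \<in> U\<close>. After step 1 the survivors are the \<open>U\<close> that have a
  common neighbour with values in \<open>U\<close>, but none avoiding 1.

  If a value \<open>v\<close> lies in two of the sets $X_i^\tau$, no common neighbour uses it, every family is
  invariant under toggling \<open>v\<close>, and nothing survives step \<open>v\<close>. If the $X_i^\tau$ are disjoint and
  their least value \<open>y\<close> lies in $X_j^\tau$, then the survivors of step \<open>y\<close> form a product: \<open>U\<close> has
  only 1 as a possible element in $X_j^\tau$ and meets each other $X_l^\tau$ in an arbitrary nonempty
  set. From then on the minimum of each $X_l^\tau$ matches everything except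
  $U \cap X_l^\tau = \{\min X_l^\tau\}$. In the presence of \<open>z\<close> this forces \<open>j = k\<close> and
  $z_l = \min X_l^\tau$ for \<open>l \<noteq> k\<close>.
\<close>

section \<open>Toggling and the survivors of the matching steps\<close>

definition toggle :: "'a \<Rightarrow> 'a set \<Rightarrow> 'a set" where
  "toggle x A = (if x \<in> A then A - {x} else insert x A)"

lemma toggle_commute: "toggle x (toggle y A) = toggle y (toggle x A)"
  by (auto simp: toggle_def)

text \<open>The sets in \<open>S_step\<close> and their images under \<open>mu_step\<close> are the
  lower and upper members of pairs that differ in one constant map; toggling exchanges the two, so a
  single condition removes both.\<close>

lemma S_rest_Suc_iff:
  "\<sigma> \<in> S_rest n m (Suc i) \<longleftrightarrow>
     \<sigma> \<in> S_rest n m i \<and> toggle (const_map n (Suc i)) \<sigma> \<notin> S_rest n m i"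
proof (cases "const_map n (Suc i) \<in> \<sigma>")
  case True
  let ?c = "const_map n (Suc i)" and ?Q = "S_rest n m i"
  have "\<sigma> \<in> mu_step n (Suc i) ` S_step n ?Q (Suc i) \<longleftrightarrow> \<sigma> \<in> ?Q \<and> \<sigma> - {?c} \<in> ?Q"
  proof
    assume "\<sigma> \<in> ?Q \<and> \<sigma> - {?c} \<in> ?Q"
    with True have "\<sigma> - {?c} \<in> S_step n ?Q (Suc i)" "\<sigma> = mu_step n (Suc i) (\<sigma> - {?c})"
      by (auto simp: S_step_def mu_step_def insert_absorb)
    then show "\<sigma> \<in> mu_step n (Suc i) ` S_step n ?Q (Suc i)" by blast
  qed (auto simp: S_step_def mu_step_def)
  moreover have "\<sigma> \<notin> S_step n ?Q (Suc i)" using True by (simp add: S_step_def)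
  ultimately show ?thesis using True by (auto simp: toggle_def)
next
  case False
  then show ?thesis by (auto simp: toggle_def S_step_def mu_step_def)
qed

lemma S_rest_eq:
  "S_rest n m i = nbhd_complex n m - (\<Union>j\<in>{1..i}. S_set n m j \<union> mu_step n j ` S_set n m j)"
proof (induction i)
  case (Suc i)
  let ?M = "\<lambda>j. S_set n m j \<union> mu_step n j ` S_set n m j"
  have "S_rest n m (Suc i) = S_rest n m i - ?M (Suc i)" by (simp add: S_set_def)
  also have "\<dots> = nbhd_complex n m - ((\<Union>j\<in>{1..i}. ?M j) \<union> ?M (Suc i))"
    by (simp only: Suc.IH Diff_Un Diff_Int2 Diff_eq compl_sup inf_assoc)
  also have "(\<Union>j\<in>{1..i}. ?M j) \<union> ?M (Suc i) = (\<Union>j\<in>{1..Suc i}. ?M j)"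
    by (simp add: atLeastAtMostSuc_conv Un_commute)
  finally show ?case .
qed simp

text \<open>\<open>mu\<close> picks its step by a definite description; on
  \<open>S_set n m j\<close> that step is \<open>j\<close> by \<open>mu_eq\<close>, so the image of
  \<open>S_all\<close> splits into the images removed step by step.\<close>

lemma critical_iff: "critical n m \<sigma> \<longleftrightarrow> \<sigma> \<in> S_rest n m m"
proof -
  have "mu n m ` S_set n m j = mu_step n j ` S_set n m j" if "j \<in> {1..m}" for j
    using mu_eq[OF that] by (simp cong: image_cong)
  then have "mu n m ` S_all n m = (\<Union>j\<in>{1..m}. mu_step n j ` S_set n m j)"
    by (simp add: S_all_def image_UN)
  then have "S_all n m \<union> mu n m ` S_all n m =
      (\<Union>j\<in>{1..m}. S_set n m j \<union> mu_step n j ` S_set n m j)"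
    by (simp only: S_all_def UN_Un_distrib)
  then show ?thesis by (simp only: critical_def S_rest_eq Diff_iff)
qed

section \<open>Constant maps and adjacency\<close>

lemma const_map_eq_iff: "1 \<le> n \<Longrightarrow> const_map n x = const_map n y \<longleftrightarrow> x = y"
  by (auto simp: const_map_def restrict_def fun_eq_iff)

lemma not_inj_on_const_map:
  assumes "2 \<le> n"
  shows "\<not> inj_on (const_map n x) {1..n}"
proof
  assume "inj_on (const_map n x) {1..n}"
  then have "(1::nat) = 2" by (rule inj_onD) (use assms in \<open>auto simp: const_map_def\<close>)
  then show False by simp
qed

lemma const_map_notin_inj_maps: "2 \<le> n \<Longrightarrow> const_map n x \<notin> inj_maps n m"
  using not_inj_on_const_map by (auto simp only: inj_maps_def)

lemma ex_other_index:
  assumes "2 \<le> n"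
  shows "\<exists>j\<in>{1..n}. j \<noteq> (i::nat)"
  using assms by (intro bexI[of _ "if i = 1 then 2 else 1"]) auto

lemma adj_sym: "adj n f g \<longleftrightarrow> adj n g f"
  unfolding adj_def by metis

text \<open>Adjacency compares different indices only, but with at least two indices every position
  of \<open>f\<close> is compared with another one, where the constant map has the value
  \<open>x\<close>.\<close>

lemma adj_const_map:
  assumes "2 \<le> n"
  shows "adj n f (const_map n x) \<longleftrightarrow> x \<notin> f ` {1..n}"
proof
  assume adj: "adj n f (const_map n x)"
  have "f i \<noteq> x" if "i \<in> {1..n}" for i
  proof -
    obtain j where "j \<in> {1..n}" "j \<noteq> i" using ex_other_index[OF assms] by blast
    with adj that have "f i \<noteq> const_map n x j" unfolding adj_def by metis
    with \<open>j \<in> {1..n}\<close> show ?thesis by (simp add: const_map_def)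
  qed
  then show "x \<notin> f ` {1..n}" by blast
next
  assume "x \<notin> f ` {1..n}"
  then have "f i \<noteq> x" if "i \<in> {1..n}" for i using that by blast
  then show "adj n f (const_map n x)" by (simp add: adj_def const_map_def)
qed

section \<open>Cells with a fixed injective part and their common neighbours\<close>

definition cell :: "nat \<Rightarrow> nat \<Rightarrow> (nat \<Rightarrow> nat) set \<Rightarrow> nat set \<Rightarrow> (nat \<Rightarrow> nat) set" where
  "cell n m T U = T \<union> const_map n ` ({1..m} - U)"

text \<open>The two disjuncts are a constant and an injective common neighbour of \<open>cell n m T U\<close>, where
  \<open>X i\<close> stands for $X_i^T$.\<close>

definition has_nbr :: "nat \<Rightarrow> nat \<Rightarrow> (nat \<Rightarrow> nat set) \<Rightarrow> nat set \<Rightarrow> bool" where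
  "has_nbr n m X U \<longleftrightarrow> (\<exists>x\<in>U. \<forall>i\<in>{1..n}. x \<notin> X i) \<or>
     (\<exists>w\<in>inj_maps n m. \<forall>l\<in>{1..n}. w l \<in> U \<and> (\<forall>i\<in>{1..n}. i \<noteq> l \<longrightarrow> w l \<notin> X i))"

text \<open>Adjacency to the constants outside \<open>U\<close> confines the values of a neighbour
  to \<open>U\<close>, which is why cells are indexed by their missing constants. Adjacency to
  \<open>T\<close> bans the value at \<open>l\<close> from every \<open>X_at i T\<close> with
  \<open>i \<noteq> l\<close>; a constant neighbour has its value at all indices, so that value is
  banned from all these sets.\<close>

lemma common_nbrs_cell:
  assumes n: "2 \<le> n" and U: "U \<subseteq> {1..m}"
  shows "common_nbrs n m (cell n m T U) \<noteq> {} \<longleftrightarrow> has_nbr n m (\<lambda>i. X_at i T) U"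
    (is "?L \<longleftrightarrow> ?R")
proof
  assume ?L
  then obtain g where g: "g \<in> common_nbrs n m (cell n m T U)" by blast
  then have "adj n (const_map n x) g" if "x \<in> {1..m} - U" for x
    using that by (simp add: common_nbrs_def cell_def)
  then have gc: "x \<notin> g ` {1..n}" if "x \<in> {1..m} - U" for x
    using that adj_const_map[OF n] adj_sym by blast
  from g have g: "g \<in> verts n m" "\<And>f. f \<in> T \<Longrightarrow> adj n f g"
    by (auto simp: common_nbrs_def cell_def)
  from g(1) consider x where "x \<in> {1..m}" "g = const_map n x" | "g \<in> inj_maps n m"
    by (auto simp: verts_def)
  then show ?R
  proof cases
    case (1 x)
    then have "x \<in> g ` {1..n}" using n by (force simp: const_map_def)
    with gc 1 have "x \<in> U" by blast
    moreover have "\<forall>i\<in>{1..n}. x \<notin> X_at i T"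
      using g(2) 1 adj_const_map[OF n] by (auto simp: X_at_def)
    ultimately show ?thesis by (auto simp: has_nbr_def)
  next
    case 2
    then have "g l \<in> {1..m}" if "l \<in> {1..n}" for l
      using that by (auto simp: inj_maps_def)
    with gc have "g l \<in> U" if "l \<in> {1..n}" for l using that by blast
    moreover have "g l \<notin> X_at i T" if "l \<in> {1..n}" "i \<in> {1..n}" "i \<noteq> l" for l i
      using g(2) that by (fastforce simp: X_at_def adj_def)
    ultimately show ?thesis using 2 unfolding has_nbr_def by blast
  qed
next
  assume ?R
  then consider x where "x \<in> U" "\<forall>i\<in>{1..n}. x \<notin> X_at i T"
    | w where "w \<in> inj_maps n m"
      "\<forall>l\<in>{1..n}. w l \<in> U \<and> (\<forall>i\<in>{1..n}. i \<noteq> l \<longrightarrow> w l \<notin> X_at i T)"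
    unfolding has_nbr_def by blast
  then show ?L
  proof cases
    case (1 x)
    then have "const_map n x \<in> verts n m" using U by (auto simp: verts_def)
    moreover have "adj n f (const_map n x)" if "f \<in> T" for f
      using 1 that by (auto simp: adj_const_map[OF n] X_at_def)
    moreover have "adj n (const_map n x') (const_map n x)" if "x' \<notin> U" for x'
      using 1 that by (auto simp: adj_def const_map_def)
    ultimately have "const_map n x \<in> common_nbrs n m (cell n m T U)"
      unfolding common_nbrs_def cell_def by blast
    then show ?thesis by blast
  next
    case (2 w)
    then have "w \<in> verts n m" by (auto simp: verts_def)
    moreover have "adj n f w" if "f \<in> T" for f
      using 2 that by (force simp: adj_def X_at_def)
    moreover have "adj n (const_map n x') w" if "x' \<notin> U" for x'
    proof -
      have "x' \<notin> w ` {1..n}" using 2(2) that by blast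
      then show ?thesis using adj_const_map[OF n] adj_sym by blast
    qed
    ultimately have "w \<in> common_nbrs n m (cell n m T U)"
      unfolding common_nbrs_def cell_def by blast
    then show ?thesis by blast
  qed
qed

section \<open>Survivors in terms of the missing constants\<close>

definition unmatched :: "nat \<Rightarrow> nat \<Rightarrow> (nat \<Rightarrow> nat) set \<Rightarrow> nat \<Rightarrow> nat set \<Rightarrow> bool" where
  "unmatched n m T i U \<longleftrightarrow> cell n m T U \<in> S_rest n m i"

lemma toggle_cell:
  assumes "2 \<le> n" "T \<subseteq> inj_maps n m" "x \<in> {1..m}"
  shows "toggle (const_map n x) (cell n m T U) = cell n m T (toggle x U)"
proof -
  have "const_map n x \<notin> T" using assms const_map_notin_inj_maps by blast
  moreover have "inj (const_map n)" using assms(1) by (auto simp: inj_def const_map_eq_iff)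
  ultimately show ?thesis using assms(3)
    by (auto simp: toggle_def cell_def inj_eq)
qed

lemma unmatched_Suc:
  assumes "2 \<le> n" "T \<subseteq> inj_maps n m" "Suc i \<le> m"
  shows "unmatched n m T (Suc i) U \<longleftrightarrow>
    unmatched n m T i U \<and> \<not> unmatched n m T i (toggle (Suc i) U)"
  using assms by (simp only: unmatched_def S_rest_Suc_iff toggle_cell) (simp add: toggle_cell)

lemma unmatched_1:
  assumes "2 \<le> n" "T \<subseteq> inj_maps n m" "2 \<le> m" "1 \<in> U" "U \<subseteq> {1..m}"
  shows "unmatched n m T 1 U \<longleftrightarrow>
    has_nbr n m (\<lambda>i. X_at i T) U \<and> \<not> has_nbr n m (\<lambda>i. X_at i T) (U - {1})"
proof -
  have cell: "unmatched n m T 0 V \<longleftrightarrow> cell n m T V \<noteq> {} \<and> has_nbr n m (\<lambda>i. X_at i T) V"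
    if "V \<subseteq> {1..m}" for V
    using that assms common_nbrs_cell[of n V m T]
    by (auto simp: unmatched_def nbhd_complex_def cell_def verts_def)
  \<comment> \<open>The empty set is no simplex even if \<open>has_nbr\<close> holds for it. It
    arises only from empty \<open>T\<close> and \<open>U = {1..m}\<close>; then the constant map
    with value 2 is a neighbour for \<open>U - {1}\<close> as well, so both sides of the claim are
    false.\<close>
  have "has_nbr n m (\<lambda>i. X_at i T) (U - {1})" if "cell n m T U = {}"
  proof -
    have "2 \<in> U - {1}" "T = {}" using that assms(3) by (auto simp: cell_def)
    then show ?thesis unfolding has_nbr_def X_at_def by blast
  qed
  moreover have "cell n m T (U - {1}) \<noteq> {}" using assms by (auto simp: cell_def)
  moreover have "toggle 1 U = U - {1}" using assms by (simp add: toggle_def)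
  moreover have "U - {1} \<subseteq> {1..m}" using assms by auto
  ultimately show ?thesis
    using unmatched_Suc[of n T m 0 U] assms cell[of U] cell[of "U - {1}"] by auto
qed

lemma unmatched_antimono: "i \<le> j \<Longrightarrow> unmatched n m T j U \<Longrightarrow> unmatched n m T i U"
  unfolding unmatched_def using S_rest_antimono by blast

lemma overlap_not_unmatched:
  assumes n: "2 \<le> n" and T: "T \<subseteq> inj_maps n m"
    and rs: "r \<in> {1..n}" "s \<in> {1..n}" "r \<noteq> s" "v \<in> X_at r T" "v \<in> X_at s T"
    and v: "2 \<le> v" "v \<le> m" and U: "1 \<in> U" "U \<subseteq> {1..m}"
  shows "\<not> unmatched n m T m U"
proof -
  have *: "has_nbr n m (\<lambda>i. X_at i T) V" if "has_nbr n m (\<lambda>i. X_at i T) W" "W - {v} \<subseteq> V" for V W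
  proof -
    from that(1) consider x where "x \<in> W" "\<forall>i\<in>{1..n}. x \<notin> X_at i T"
      | w where "w \<in> inj_maps n m"
        "\<forall>l\<in>{1..n}. w l \<in> W \<and> (\<forall>i\<in>{1..n}. i \<noteq> l \<longrightarrow> w l \<notin> X_at i T)"
      unfolding has_nbr_def by blast
    then show ?thesis
    proof cases
      case (1 x)
      then have "x \<noteq> v" using rs by auto
      with 1 that(2) show ?thesis by (auto simp: has_nbr_def)
    next
      case (2 w)
      \<comment> \<open>One of \<open>r\<close> and \<open>s\<close> differs from \<open>l\<close>,
        and \<open>w l\<close> avoids the value set there.\<close>
      then have "w l \<noteq> v" if "l \<in> {1..n}" for l using rs that by metis
      with 2 that(2) have "\<forall>l\<in>{1..n}. w l \<in> V" by blast
      with 2 show ?thesis by (auto simp: has_nbr_def)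
    qed
  qed
  have sub: "V - {1} - {v} \<subseteq> toggle v V - {1}" "toggle v V - {1} - {v} \<subseteq> V - {1}"
    "V - {v} \<subseteq> toggle v V" "toggle v V - {v} \<subseteq> V" for V :: "nat set"
    by (auto simp: toggle_def)
  \<comment> \<open>The criterion at step 1 involves only \<open>has_nbr\<close>, which ignores
    \<open>v\<close>; later steps inherit the invariance because toggles commute. At
    \<open>i = v - 1\<close> a set survives together with its partner or not at all, so step
    \<open>v\<close> leaves nothing.\<close>
  have inv: "unmatched n m T i (toggle v V) \<longleftrightarrow> unmatched n m T i V"
    if "1 \<le> i" "i < v" "1 \<in> V" "V \<subseteq> {1..m}" for i V
    using that
  proof (induction i arbitrary: V rule: dec_induct)
    case base
    have "1 \<in> toggle v V" "toggle v V \<subseteq> {1..m}"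
      using base v by (auto simp: toggle_def)
    then show ?case
      using * sub[of V] base v by (auto simp only: unmatched_1[OF n T])
  next
    case (step i)
    have V': "1 \<in> toggle (Suc i) V" "toggle (Suc i) V \<subseteq> {1..m}"
      using step v by (auto simp: toggle_def)
    have "unmatched n m T i (toggle v V) \<longleftrightarrow> unmatched n m T i V"
      "unmatched n m T i (toggle v (toggle (Suc i) V)) \<longleftrightarrow> unmatched n m T i (toggle (Suc i) V)"
      using step V' by auto
    then show ?case
      using step v by (simp add: unmatched_Suc[OF n T] toggle_commute[of "Suc i" v])
  qed
  have "\<not> unmatched n m T (Suc (v - 1)) U"
    using v U inv[of "v - 1" U] unmatched_Suc[OF n T, of "v - 1" U] by auto
  then show ?thesis using v unmatched_antimono[of v m] by auto
qed

section \<open>Disjoint value sets\<close>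

lemma choose_inj_map:
  assumes ne: "\<And>l. l \<in> {1..n} \<Longrightarrow> V l \<noteq> {}"
    and V: "\<And>l. l \<in> {1..n} \<Longrightarrow> V l \<subseteq> {1..m}"
    and disj: "\<And>r s. r \<in> {1..n} \<Longrightarrow> s \<in> {1..n} \<Longrightarrow> r \<noteq> s \<Longrightarrow> V r \<inter> V s = {}"
  obtains w where "w \<in> inj_maps n m" "\<And>l. l \<in> {1..n} \<Longrightarrow> w l \<in> V l"
proof -
  \<comment> \<open>Any choice is injective by disjointness; the restriction makes it
    extensional.\<close>
  define w where "w = (\<lambda>l\<in>{1..n}. SOME x. x \<in> V l)"
  have w: "w l \<in> V l" if "l \<in> {1..n}" for l
    using ne[OF that] that by (simp add: w_def some_in_eq)
  have "inj_on w {1..n}"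
  proof (rule inj_onI, rule ccontr)
    fix r s assume rs: "r \<in> {1..n}" "s \<in> {1..n}" "w r = w s" "r \<noteq> s"
    then show False using w[OF rs(1)] w[OF rs(2)] disj[OF rs(1,2,4)] by auto
  qed
  moreover have "w \<in> {1..n} \<rightarrow>\<^sub>E {1..m}"
  proof (rule PiE_I)
    fix l assume "l \<in> {1..n}"
    then show "w l \<in> {1..m}" using w V by blast
  next
    fix l assume "l \<notin> {1..n}"
    then show "w l = undefined" unfolding w_def by (rule restrict_apply[THEN trans, OF if_not_P])
  qed
  ultimately have "w \<in> inj_maps n m" by (simp only: inj_maps_def mem_Collect_eq simp_thms)
  with w that show thesis by blast
qed

text \<open>As the sets \<open>X l\<close> cover \<open>U\<close>, no constant map is a neighbour,
  and the value at \<open>l\<close> of an injective neighbour lies in some \<open>X i\<close>, which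
  can only be \<open>X l\<close>. Conversely, by disjointness, any choice from the sets
  \<open>U \<inter> X l\<close> is an injective neighbour.\<close>

lemma has_nbr_disjoint:
  assumes X: "\<And>l. l \<in> {1..n} \<Longrightarrow> X l \<subseteq> {1..m}"
    and disj: "\<And>r s. r \<in> {1..n} \<Longrightarrow> s \<in> {1..n} \<Longrightarrow> r \<noteq> s \<Longrightarrow> X r \<inter> X s = {}"
    and U: "U \<subseteq> (\<Union>l\<in>{1..n}. X l)"
  shows "has_nbr n m X U \<longleftrightarrow> (\<forall>l\<in>{1..n}. U \<inter> X l \<noteq> {})"
proof
  assume "has_nbr n m X U"
  then obtain w where w: "\<forall>l\<in>{1..n}. w l \<in> U \<and> (\<forall>i\<in>{1..n}. i \<noteq> l \<longrightarrow> w l \<notin> X i)"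
    using U unfolding has_nbr_def by blast
  show "\<forall>l\<in>{1..n}. U \<inter> X l \<noteq> {}"
  proof
    fix l assume l: "l \<in> {1..n}"
    with w U obtain i where "i \<in> {1..n}" "w l \<in> X i" by blast
    with w l have "w l \<in> X l" by metis
    with w l show "U \<inter> X l \<noteq> {}" by blast
  qed
next
  assume ne: "\<forall>l\<in>{1..n}. U \<inter> X l \<noteq> {}"
  obtain w where w: "w \<in> inj_maps n m" "\<And>l. l \<in> {1..n} \<Longrightarrow> w l \<in> U \<inter> X l"
  proof (rule choose_inj_map)
    show "U \<inter> X l \<noteq> {}" if "l \<in> {1..n}" for l using ne that by blast
    show "U \<inter> X l \<subseteq> {1..m}" if "l \<in> {1..n}" for l using X[OF that] by blast
    show "U \<inter> X r \<inter> (U \<inter> X s) = {}" if "r \<in> {1..n}" "s \<in> {1..n}" "r \<noteq> s" for r s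
      using disj[OF that] by blast
  qed (rule that)
  have "w l \<in> U \<and> (\<forall>i\<in>{1..n}. i \<noteq> l \<longrightarrow> w l \<notin> X i)" if "l \<in> {1..n}" for l
    using w(2)[OF that] disj[OF that] by blast
  with w(1) show "has_nbr n m X U" unfolding has_nbr_def by blast
qed

lemma has_nbr_uncovered: "x \<in> U \<Longrightarrow> x \<notin> (\<Union>l\<in>{1..n}. X l) \<Longrightarrow> has_nbr n m X U"
  by (auto simp: has_nbr_def)

text \<open>For \<open>y > 1\<close>, the steps \<open>2, \<dots>, y - 1\<close> match nothing, since a value \<open>t < y\<close> in \<open>U\<close> gives the
  neighbour \<open>\<langle>t\<rangle>\<close>. Step \<open>y\<close> then forces all \<open>U \<inter> X_at l T\<close> with \<open>l \<noteq> j\<close> to be nonempty.\<close>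

lemma unmatched_least:
  assumes n: "2 \<le> n" and m: "2 \<le> m" and T: "T \<subseteq> inj_maps n m"
    and XT: "\<And>l. l \<in> {1..n} \<Longrightarrow> X_at l T \<subseteq> {1..m}"
    and disj: "\<And>r s. r \<in> {1..n} \<Longrightarrow> s \<in> {1..n} \<Longrightarrow> r \<noteq> s \<Longrightarrow> X_at r T \<inter> X_at s T = {}"
    and j: "j \<in> {1..n}" "y \<in> X_at j T"
    and least: "\<And>l x. l \<in> {1..n} \<Longrightarrow> x \<in> X_at l T \<Longrightarrow> y \<le> x"
    and U: "1 \<in> U" "U \<subseteq> {1..m}"
  shows "unmatched n m T y U \<longleftrightarrow> U - {1} \<subseteq> X_all n T \<and> U \<inter> X_at j T \<subseteq> {1} \<and>
    (\<forall>l\<in>{1..n} - {j}. U \<inter> X_at l T \<noteq> {})"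
proof (cases "y = 1")
  case True
  then have 1: "1 \<in> X_at j T" "1 \<in> X_all n T" using j by (auto simp: X_all_def)
  show ?thesis
  proof (cases "U \<subseteq> X_all n T")
    case False
    then have "has_nbr n m (\<lambda>i. X_at i T) (U - {1})"
      using 1(2) by (auto simp: X_all_def intro!: has_nbr_uncovered)
    then show ?thesis using False 1(2) unmatched_1[OF n T m U] True by auto
  next
    case sub: True
    have "has_nbr n m (\<lambda>i. X_at i T) V \<longleftrightarrow> (\<forall>l\<in>{1..n}. V \<inter> X_at l T \<noteq> {})" if "V \<subseteq> U" for V
      using sub that XT disj by (intro has_nbr_disjoint) (auto simp: X_all_def)
    then have "unmatched n m T y U \<longleftrightarrow> (\<forall>l\<in>{1..n}. U \<inter> X_at l T \<noteq> {}) \<and>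
        \<not> (\<forall>l\<in>{1..n}. (U - {1}) \<inter> X_at l T \<noteq> {})"
      using unmatched_1[OF n T m U] True by auto
    \<comment> \<open>The value 1 lies in \<open>X_at j T\<close> alone, so removing it can destroy
      the neighbours only by emptying \<open>U \<inter> X_at j T\<close>.\<close>
    moreover have "(U - {1}) \<inter> X_at l T = U \<inter> X_at l T" if "l \<in> {1..n} - {j}" for l
      using 1(1) disj[of l j] that j(1) by blast
    moreover have "U \<inter> X_at j T \<noteq> {}" using 1(1) U(1) by blast
    ultimately show ?thesis using sub j(1) by blast
  qed
next
  case False
  have y: "2 \<le> y" "y \<le> m" using False XT[OF j(1)] j(2) by force+
  have 1: "1 \<notin> X_all n T" using least y by (force simp: X_all_def)
  \<comment> \<open>As 1 is uncovered and lies in \<open>V\<close>, the constant map with value 1 is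
    a neighbour; surviving step 1 thus means that \<open>V - {1}\<close> has none.\<close>
  have base: "unmatched n m T i V \<longleftrightarrow>
      V - {1} \<subseteq> X_all n T \<and> (\<exists>l\<in>{1..n}. V \<inter> X_at l T = {})"
    if "1 \<le> i" "i < y" "1 \<in> V" "V \<subseteq> {1..m}" for i V
    using that
  proof (induction i arbitrary: V rule: dec_induct)
    case base
    have nbr: "has_nbr n m (\<lambda>i. X_at i T) V"
      using base 1 by (auto simp: X_all_def intro!: has_nbr_uncovered[of 1])
    show ?case
    proof (cases "V - {1} \<subseteq> X_all n T")
      case True
      have "has_nbr n m (\<lambda>i. X_at i T) (V - {1}) \<longleftrightarrow> (\<forall>l\<in>{1..n}. (V - {1}) \<inter> X_at l T \<noteq> {})"
        using True XT disj by (intro has_nbr_disjoint) (auto simp: X_all_def)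
      moreover have "(V - {1}) \<inter> X_at l T = V \<inter> X_at l T" if "l \<in> {1..n}" for l
        using 1 that by (auto simp: X_all_def)
      ultimately show ?thesis using True nbr unmatched_1[OF n T m] base by auto
    next
      case False
      then have "has_nbr n m (\<lambda>i. X_at i T) (V - {1})"
        by (auto simp: X_all_def intro!: has_nbr_uncovered)
      then show ?thesis using False unmatched_1[OF n T m] base by auto
    qed
  next
    case (step i)
    have V': "1 \<in> toggle (Suc i) V" "toggle (Suc i) V \<subseteq> {1..m}"
      using step y by (auto simp: toggle_def)
    have "Suc i \<notin> X_all n T" using least step.prems by (force simp: X_all_def)
    then have "\<not> (V - {1} \<subseteq> X_all n T \<and> toggle (Suc i) V - {1} \<subseteq> X_all n T)"
      using step.hyps by (auto simp: toggle_def)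
    then show ?case
      using step V' y by (auto simp: unmatched_Suc[OF n T])
  qed
  have yX: "y \<in> X_all n T" using j by (auto simp: X_all_def)
  have U': "1 \<in> toggle y U" "toggle y U \<subseteq> {1..m}"
    using U y by (auto simp: toggle_def)
  have "unmatched n m T y U \<longleftrightarrow> unmatched n m T (y - 1) U \<and> \<not> unmatched n m T (y - 1) (toggle y U)"
    using unmatched_Suc[OF n T, of "y - 1"] y by auto
  also have "\<dots> \<longleftrightarrow> (U - {1} \<subseteq> X_all n T \<and> (\<exists>l\<in>{1..n}. U \<inter> X_at l T = {})) \<and>
      \<not> (toggle y U - {1} \<subseteq> X_all n T \<and> (\<exists>l\<in>{1..n}. toggle y U \<inter> X_at l T = {}))"
    using base[of "y - 1" U] base[of "y - 1" "toggle y U"] y U U' by simp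
  also have "toggle y U - {1} \<subseteq> X_all n T \<longleftrightarrow> U - {1} \<subseteq> X_all n T"
    using yX by (auto simp: toggle_def)
  finally have *: "unmatched n m T y U \<longleftrightarrow> U - {1} \<subseteq> X_all n T \<and>
      (\<exists>l\<in>{1..n}. U \<inter> X_at l T = {}) \<and> (\<forall>l\<in>{1..n}. toggle y U \<inter> X_at l T \<noteq> {})"
    by blast
  \<comment> \<open>Toggling \<open>y\<close> changes only the intersection at \<open>j\<close>. If
    the toggled set meets every value set and \<open>U\<close> does not, then \<open>U\<close>
    misses exactly \<open>X_at j T\<close>; conversely, adding \<open>y\<close> fills that
    gap.\<close>
  have other: "toggle y U \<inter> X_at l T = U \<inter> X_at l T" if "l \<in> {1..n} - {j}" for l
    using disj[of l j] that j by (auto simp: toggle_def)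
  have own: "toggle y U \<inter> X_at j T \<noteq> {}" if "U \<inter> X_at j T = {}"
    using that j(2) by (auto simp: toggle_def)
  \<comment> \<open>Here 1 is uncovered, so the bound \<open>{1}\<close> means emptiness; this form
    also fits the case \<open>y = 1\<close>.\<close>
  have "U \<inter> X_at j T \<subseteq> {1} \<longleftrightarrow> U \<inter> X_at j T = {}"
    using 1 j(1) by (auto simp: X_all_def)
  with * other own j(1) show ?thesis by (metis DiffI Diff_iff singletonD)
qed

text \<open>Consider step \<open>t = Suc i\<close>. If \<open>t\<close> is the minimum of
  \<open>X_at l T\<close> with \<open>l \<noteq> j\<close>, toggling it pairs all nonempty
  intersections with that set except \<open>{t}\<close>, whose partner is empty. No other
  \<open>t\<close> pairs two survivors: it differs from 1, so it is not in \<open>U\<close> when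
  uncovered or in \<open>X_at j T\<close>, and above the minimum of another \<open>X_at l T\<close>
  the intersection is already fixed.\<close>

lemma unmatched_ge:
  assumes n: "2 \<le> n" and m: "2 \<le> m" and T: "T \<subseteq> inj_maps n m"
    and XT: "\<And>l. l \<in> {1..n} \<Longrightarrow> X_at l T \<subseteq> {1..m}"
    and disj: "\<And>r s. r \<in> {1..n} \<Longrightarrow> s \<in> {1..n} \<Longrightarrow> r \<noteq> s \<Longrightarrow> X_at r T \<inter> X_at s T = {}"
    and j: "j \<in> {1..n}" "y \<in> X_at j T"
    and least: "\<And>l x. l \<in> {1..n} \<Longrightarrow> x \<in> X_at l T \<Longrightarrow> y \<le> x"
    and U: "1 \<in> U" "U \<subseteq> {1..m}" and i: "y \<le> i" "i \<le> m"
  shows "unmatched n m T i U \<longleftrightarrow> U - {1} \<subseteq> X_all n T \<and> U \<inter> X_at j T \<subseteq> {1} \<and>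
    (\<forall>l\<in>{1..n} - {j}. U \<inter> X_at l T \<noteq> {} \<and>
       (Min (X_at l T) \<le> i \<longrightarrow> U \<inter> X_at l T = {Min (X_at l T)}))"
  using i U
proof (induction i arbitrary: U rule: dec_induct)
  case base
  \<comment> \<open>At the start no guard holds: \<open>y\<close> is the least value and lies in
    \<open>X_at j T\<close> only, so the other minima exceed it.\<close>
  have "\<not> Min (X_at l T) \<le> y" if "l \<in> {1..n} - {j}" "U \<inter> X_at l T \<noteq> {}" for l
  proof -
    have "finite (X_at l T)" using XT[of l] that(1) finite_subset by blast
    then have "Min (X_at l T) \<in> X_at l T" using that(2) by (intro Min_in) auto
    then show ?thesis using least[of l] disj[of l j] j that(1) by fastforce
  qed
  then have "(\<forall>l\<in>{1..n} - {j}. U \<inter> X_at l T \<noteq> {} \<and>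
       (Min (X_at l T) \<le> y \<longrightarrow> U \<inter> X_at l T = {Min (X_at l T)})) \<longleftrightarrow>
      (\<forall>l\<in>{1..n} - {j}. U \<inter> X_at l T \<noteq> {})"
    by blast
  moreover have "unmatched n m T y U \<longleftrightarrow> U - {1} \<subseteq> X_all n T \<and> U \<inter> X_at j T \<subseteq> {1} \<and>
      (\<forall>l\<in>{1..n} - {j}. U \<inter> X_at l T \<noteq> {})"
    by (rule unmatched_least[OF n m T XT disj j least base(2,3)])
  ultimately show ?case by (simp only:)
next
  case (step i)
  define t where "t = Suc i"
  define F where "F = (\<lambda>i U. U - {1} \<subseteq> X_all n T \<and> U \<inter> X_at j T \<subseteq> {1} \<and>
    (\<forall>l\<in>{1..n} - {j}. U \<inter> X_at l T \<noteq> {} \<and>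
       (Min (X_at l T) \<le> i \<longrightarrow> U \<inter> X_at l T = {Min (X_at l T)})))"
  have fin: "finite (X_at l T)" if "l \<in> {1..n}" for l
    using XT[OF that] finite_subset by blast
  have "1 \<le> y" using XT[OF j(1)] j(2) by auto
  then have t: "t \<noteq> 1" "y < t" "t \<le> m" "t \<in> {1..m}" using step.hyps step.prems by (auto simp: t_def)
  have U': "1 \<in> toggle t U" "toggle t U \<subseteq> {1..m}"
    using step.prems t by (auto simp: toggle_def)
  have "unmatched n m T t U \<longleftrightarrow> F i U \<and> \<not> F i (toggle t U)"
    using step U' t unmatched_Suc[OF n T, of i U] by (simp add: F_def t_def)
  also have "\<dots> \<longleftrightarrow> F t U"
  \<comment> \<open>\<open>Min\<close> of the empty set is unspecified, hence the explicit
    nonemptiness.\<close>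
  proof (cases "\<exists>l\<in>{1..n} - {j}. t = Min (X_at l T) \<and> X_at l T \<noteq> {}")
    case True
    then obtain l where l: "l \<in> {1..n} - {j}" "t = Min (X_at l T)" "X_at l T \<noteq> {}" by blast
    then have tl: "t \<in> X_at l T" using fin by auto
    have tn: "t \<notin> X_at l' T" if "l' \<in> {1..n}" "l' \<noteq> l" for l'
      using disj[of l l'] that l(1) tl by auto
    have Int: "toggle t U \<inter> X_at l' T = U \<inter> X_at l' T" if "l' \<in> {1..n}" "l' \<noteq> l" for l'
      using tn[OF that] by (auto simp: toggle_def)
    have Min_ne: "Min (X_at l' T) \<noteq> t" if "l' \<in> {1..n}" "l' \<noteq> l" "U \<inter> X_at l' T \<noteq> {}" for l'
      using Min_in[OF fin[OF that(1)]] tn[OF that(1,2)] that(3) by auto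
    have tX: "t \<in> X_all n T" using tl l(1) by (auto simp: X_all_def)
    have sub: "toggle t U - {1} \<subseteq> X_all n T \<longleftrightarrow> U - {1} \<subseteq> X_all n T"
      using tX by (auto simp: toggle_def)
    have jl: "j \<noteq> l" using l(1) by auto
    have lt: "Min (X_at l T) \<le> t" "\<not> Min (X_at l T) \<le> i" using l(2) by (auto simp: t_def)
    \<comment> \<open>The guard at \<open>l\<close> is still off for \<open>i\<close>, so the
      toggled set need only meet \<open>X_at l T\<close>; nothing changes at the other
      indices.\<close>
    have F1: "F i (toggle t U) \<longleftrightarrow> toggle t U \<inter> X_at l T \<noteq> {}" if "F i U"
    proof -
      have "F i (toggle t U) \<longleftrightarrow> (\<forall>l'\<in>{1..n} - {j}. toggle t U \<inter> X_at l' T \<noteq> {} \<and>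
         (Min (X_at l' T) \<le> i \<longrightarrow> toggle t U \<inter> X_at l' T = {Min (X_at l' T)}))"
        using that sub Int[OF j(1) jl] by (simp add: F_def)
      also have "\<dots> \<longleftrightarrow> toggle t U \<inter> X_at l T \<noteq> {}"
        using that Int l(1) lt unfolding F_def by (metis DiffD1)
      finally show ?thesis .
    qed
    have F2: "F t U \<longleftrightarrow> U \<inter> X_at l T = {t}" if "F i U"
    proof -
      have "Min (X_at l' T) \<le> t \<longleftrightarrow> Min (X_at l' T) \<le> i" if "l' \<in> {1..n} - {j}" "l' \<noteq> l" for l'
        using Min_ne[of l'] that \<open>F i U\<close> by (auto simp: F_def t_def le_Suc_eq)
      then show ?thesis using that l(1,2) lt unfolding F_def by metis
    qed
    have F3: "F i U" if "F t U" using that by (auto simp: F_def t_def)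
    have "toggle t U \<inter> X_at l T = {} \<longleftrightarrow> U \<inter> X_at l T = {t}"
      if "U \<inter> X_at l T \<noteq> {}"
      using tl that by (auto simp: toggle_def split: if_splits)
    moreover have "U \<inter> X_at l T \<noteq> {}" if "F i U" using that l(1) by (auto simp: F_def)
    ultimately show ?thesis using F1 F2 F3 by blast
  next
    case False
    have "F t U \<longleftrightarrow> F i U"
    proof -
      have "Min (X_at l T) \<le> t \<longleftrightarrow> Min (X_at l T) \<le> i"
        if "l \<in> {1..n} - {j}" "U \<inter> X_at l T \<noteq> {}" for l
      proof -
        have "Min (X_at l T) \<noteq> t" using False that by blast
        then show ?thesis by (auto simp: t_def le_Suc_eq)
      qed
      then show ?thesis unfolding F_def by blast
    qed
    moreover have "\<not> (F i U \<and> F i (toggle t U))"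
    proof
      assume F: "F i U \<and> F i (toggle t U)"
      have "t \<in> U \<or> t \<in> toggle t U" by (auto simp: toggle_def)
      then have "t \<in> X_all n T" using F t(1) by (auto simp: F_def)
      then obtain l where l: "l \<in> {1..n}" "t \<in> X_at l T" by (auto simp: X_all_def)
      show False
      proof (cases "l = j")
        case True
        then show ?thesis
          using F l(2) t(1) by (auto simp: F_def toggle_def split: if_splits)
      next
        case lj: False
        then have "Min (X_at l T) \<noteq> t" using False l by auto
        moreover have "Min (X_at l T) \<le> t" using fin l by simp
        ultimately have "Min (X_at l T) \<le> i" by (simp add: t_def)
        then have "U \<inter> X_at l T = toggle t U \<inter> X_at l T"
          using F lj l(1) by (auto simp: F_def)
        then show ?thesis using l(2) by (auto simp: toggle_def split: if_splits)
      qed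
    qed
    ultimately show ?thesis by blast
  qed
  finally show ?case by (simp add: F_def t_def)
qed

section \<open>The critical cells below an injective neighbour taking the value 1\<close>

theorem theorem4p8:
  fixes n m k :: nat and z :: "nat \<Rightarrow> nat" and \<sigma> \<tau> :: "(nat \<Rightarrow> nat) set"
  assumes "n \<ge> 3" and "m \<ge> n + 1"
    and "\<sigma> \<in> nbhd_complex n m"
    and "z \<in> inj_maps n m" and "\<sigma> \<subseteq> common_nbrs n m {z}"
    and "k \<in> {1..n}" and "z k = 1"
  defines "\<tau> \<equiv> {f \<in> \<sigma>. inj_on f {1..n}}"
  shows "critical n m \<sigma> \<longleftrightarrow>
      (X_all n \<sigma> = {1..m} \<or> X_all n \<sigma> = {1..m} - {1})
    \<and> (\<forall>x \<in> {1..m} - z ` {1..n}. const_map n x \<in> \<sigma>)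
    \<and> (\<forall>i \<in> {1..n}. \<forall>x \<in> X_at i \<tau>. x \<ge> z i)
    \<and> (\<forall>r \<in> {1..n}. \<forall>s \<in> {1..n}. r \<noteq> s \<longrightarrow> X_at r \<tau> \<inter> X_at s \<tau> = {})
    \<and> (\<exists>y \<in> X_at k \<tau>. y < Min (z ` ({1..n} - {k})))"
  (is "_ \<longleftrightarrow> ?i \<and> ?ii \<and> ?iii \<and> ?iv \<and> ?v")
proof -
  have n: "2 \<le> n" and m: "2 \<le> m" using assms(1,2) by auto
  have verts: "\<sigma> \<subseteq> verts n m" using assms(3) by (simp add: nbhd_complex_def)
  have verts_cases: "(\<exists>x\<in>{1..m}. f = const_map n x) \<or> f \<in> inj_maps n m" if "f \<in> \<sigma>" for f
    using subsetD[OF verts that] by (auto simp only: verts_def)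
  have T: "\<tau> \<subseteq> inj_maps n m"
    using verts_cases not_inj_on_const_map[OF n] unfolding \<tau>_def by blast
  define U where "U = {x \<in> {1..m}. const_map n x \<notin> \<sigma>}"
  have \<sigma>: "\<sigma> = cell n m \<tau> U"
  proof
    have "f \<in> \<tau>" if "f \<in> \<sigma>" "f \<in> inj_maps n m" for f
      using that by (simp add: \<tau>_def inj_maps_def)
    moreover have "const_map n x \<in> const_map n ` ({1..m} - U)"
      if "const_map n x \<in> \<sigma>" "x \<in> {1..m}" for x
      using that by (auto simp: U_def)
    ultimately show "\<sigma> \<subseteq> cell n m \<tau> U"
      using verts_cases unfolding cell_def by blast
  qed (auto simp: cell_def U_def \<tau>_def)
  have adj: "adj n z f" if "f \<in> \<sigma>" for f
    using assms(5) that by (auto simp: common_nbrs_def)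
  have z: "z l \<in> {1..m}" if "l \<in> {1..n}" for l
    using assms(4) that by (auto simp: inj_maps_def)
  have zinj: "z l = z l' \<longleftrightarrow> l = l'" if "l \<in> {1..n}" "l' \<in> {1..n}" for l l'
    using assms(4) that by (intro inj_on_eq_iff[of z "{1..n}"]) (simp_all only: inj_maps_def mem_Collect_eq)
  \<comment> \<open>As a common neighbour, \<open>z\<close> takes its values in \<open>U\<close> and
    avoids the value sets at foreign indices; in particular 1, which is \<open>z k\<close>, lies in
    \<open>U\<close>, as the survivor lemmas require.\<close>
  have zU: "z l \<in> U" if "l \<in> {1..n}" for l
    using z[OF that] adj adj_const_map[OF n] that unfolding U_def by blast
  have zX: "z l \<notin> X_at i \<tau>" if "l \<in> {1..n}" "i \<in> {1..n}" "i \<noteq> l" for l i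
    using adj that by (force simp: X_at_def \<tau>_def adj_def)
  have U: "1 \<in> U" "U \<subseteq> {1..m}" using zU[OF assms(6)] assms(7) by (auto simp: U_def)
  have XT: "X_at l \<tau> \<subseteq> {1..m}" if "l \<in> {1..n}" for l
  proof
    fix x assume "x \<in> X_at l \<tau>"
    then obtain f where f: "f \<in> \<tau>" "x = f l" by (auto simp: X_at_def)
    then have "f \<in> {1..n} \<rightarrow>\<^sub>E {1..m}" using T unfolding inj_maps_def by blast
    then show "x \<in> {1..m}" unfolding f(2) using that by (rule PiE_mem)
  qed
  have fin: "finite (X_at l \<tau>)" if "l \<in> {1..n}" for l
    using XT[OF that] finite_subset by blast
  have crit: "critical n m \<sigma> \<longleftrightarrow> unmatched n m \<tau> m U"
    by (simp add: critical_iff unmatched_def flip: \<sigma>)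
  have Xall: "X_all n \<sigma> = X_all n \<tau> \<union> ({1..m} - U)"
  proof -
    have "X_at i \<sigma> = X_at i \<tau> \<union> ({1..m} - U)" if "i \<in> {1..n}" for i
    proof -
      have "X_at i \<sigma> = (\<lambda>f. f i) ` \<tau> \<union> (\<lambda>f. f i) ` const_map n ` ({1..m} - U)"
        unfolding X_at_def by (subst \<sigma>) (auto simp: cell_def)
      also have "(\<lambda>f. f i) ` const_map n ` ({1..m} - U) = {1..m} - U"
        using that by (simp add: image_image const_map_def)
      finally show ?thesis by (auto simp: X_at_def)
    qed
    then have "X_all n \<sigma> = (\<Union>i\<in>{1..n}. X_at i \<tau> \<union> ({1..m} - U))"
      unfolding X_all_def by (intro SUP_cong refl)
    also have "\<dots> = X_all n \<tau> \<union> ({1..m} - U)"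
      using n unfolding X_all_def UN_Un_distrib by simp
    finally show ?thesis .
  qed
  have "X_all n \<sigma> \<subseteq> {1..m}" unfolding Xall using XT unfolding X_all_def by blast
  \<comment> \<open>The values missed by \<open>\<sigma>\<close> are the uncovered elements of
    \<open>U\<close>, so (i) says that only 1 may be uncovered.\<close>
  then have i: "?i \<longleftrightarrow> U - {1} \<subseteq> X_all n \<tau>" using Xall U by auto
  have ii: "?ii \<longleftrightarrow> U \<subseteq> z ` {1..n}" by (auto simp: U_def)
  have "finite (z ` ({1..n} - {k}))" "z ` ({1..n} - {k}) \<noteq> {}"
    using ex_other_index[OF n, of k] by auto
  then have v: "?v \<longleftrightarrow> (\<exists>y \<in> X_at k \<tau>. \<forall>l\<in>{1..n} - {k}. y < z l)"
    by (simp add: Min_gr_iff)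
  have z_ne_1: "z l \<noteq> 1" if "l \<in> {1..n} - {k}" for l
    using zinj[of l k] that assms(6,7) by auto
  have z_in: "z l \<in> X_at l \<tau>" if "U - {1} \<subseteq> X_all n \<tau>" "l \<in> {1..n} - {k}" for l
  proof -
    have "z l \<in> X_all n \<tau>" using that zU[of l] z_ne_1[of l] by blast
    then obtain i where "i \<in> {1..n}" "z l \<in> X_at i \<tau>" unfolding X_all_def by blast
    with zX[of l i] that(2) show ?thesis by blast
  qed
  show ?thesis
  proof (cases ?iv)
    case False
    then obtain r s v where rs: "r \<in> {1..n}" "s \<in> {1..n}" "r \<noteq> s" "v \<in> X_at r \<tau>" "v \<in> X_at s \<tau>"
      by blast
    \<comment> \<open>The value 1, being \<open>z k\<close>, is banned from every value set except
      the one at \<open>k\<close>, so it lies in no overlap.\<close>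
    then have "v \<noteq> 1" using zX[of k r] zX[of k s] assms(6,7) by auto
    then have "2 \<le> v" "v \<le> m" using subsetD[OF XT[OF rs(1)] rs(4)] by auto
    with False show ?thesis
      using crit overlap_not_unmatched[OF n T rs _ _ U] by auto
  next
    case iv: True
    show ?thesis
    \<comment> \<open>Without injective maps there is no least value. Then some \<open>z l\<close>
      with \<open>l \<noteq> k\<close> is an uncovered element of \<open>U\<close> other than 1, so
      step 1 matches the cell, while (v) fails for lack of a candidate.\<close>
    proof (cases "X_all n \<tau> = {}")
      case True
      obtain l where l: "l \<in> {1..n} - {k}" using ex_other_index[OF n, of k] by auto
      have "has_nbr n m (\<lambda>i. X_at i \<tau>) (U - {1})"
        using l zU[of l] z_ne_1[of l] True
        by (intro has_nbr_uncovered[of "z l"]) (auto simp: X_all_def)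
      then have "\<not> unmatched n m \<tau> m U"
        using unmatched_1[OF n T m U] unmatched_antimono[of 1 m] m by auto
      moreover have "\<not> ?v" using True assms(6) by (auto simp: X_all_def)
      ultimately show ?thesis using crit by blast
    next
      case False
      define y where "y = Min (X_all n \<tau>)"
      have finX: "finite (X_all n \<tau>)" using fin by (auto simp: X_all_def)
      then have "y \<in> X_all n \<tau>" using False by (simp add: y_def)
      then obtain j where j: "j \<in> {1..n}" "y \<in> X_at j \<tau>" by (auto simp: X_all_def)
      have least: "y \<le> x" if "l \<in> {1..n}" "x \<in> X_at l \<tau>" for l x
        using finX that by (auto simp: y_def X_all_def intro!: Min_le)
      have disj: "X_at r \<tau> \<inter> X_at s \<tau> = {}" if "r \<in> {1..n}" "s \<in> {1..n}" "r \<noteq> s" for r s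
        using iv that by blast
      have "y \<le> m" using subsetD[OF XT[OF j(1)] j(2)] by simp
      \<comment> \<open>After step \<open>m\<close> the minima of all nonempty value sets have been
        passed, so the guard in \<open>unmatched_ge\<close> disappears.\<close>
      have um: "unmatched n m \<tau> m U \<longleftrightarrow> U - {1} \<subseteq> X_all n \<tau> \<and> U \<inter> X_at j \<tau> \<subseteq> {1} \<and>
        (\<forall>l\<in>{1..n} - {j}. U \<inter> X_at l \<tau> = {Min (X_at l \<tau>)})"
      proof -
        have "(U \<inter> X_at l \<tau> \<noteq> {} \<and>
            (Min (X_at l \<tau>) \<le> m \<longrightarrow> U \<inter> X_at l \<tau> = {Min (X_at l \<tau>)})) \<longleftrightarrow>
          U \<inter> X_at l \<tau> = {Min (X_at l \<tau>)}" if "l \<in> {1..n} - {j}" for l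
        proof -
          have "Min (X_at l \<tau>) \<le> m" if "U \<inter> X_at l \<tau> \<noteq> {}"
          proof -
            have "Min (X_at l \<tau>) \<in> X_at l \<tau>"
              using that fin \<open>l \<in> {1..n} - {j}\<close> by (intro Min_in) auto
            then show ?thesis using XT[of l] \<open>l \<in> {1..n} - {j}\<close> by auto
          qed
          then show ?thesis by blast
        qed
        moreover have "unmatched n m \<tau> m U \<longleftrightarrow> U - {1} \<subseteq> X_all n \<tau> \<and> U \<inter> X_at j \<tau> \<subseteq> {1} \<and>
          (\<forall>l\<in>{1..n} - {j}. U \<inter> X_at l \<tau> \<noteq> {} \<and>
             (Min (X_at l \<tau>) \<le> m \<longrightarrow> U \<inter> X_at l \<tau> = {Min (X_at l \<tau>)}))"
          by (rule unmatched_ge[OF n m T XT disj j least U \<open>y \<le> m\<close> order_refl])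
        ultimately show ?thesis by (simp only: cong: ball_cong)
      qed
      have "unmatched n m \<tau> m U \<longleftrightarrow> U - {1} \<subseteq> X_all n \<tau> \<and> U \<subseteq> z ` {1..n} \<and> ?iii \<and>
        (\<exists>y \<in> X_at k \<tau>. \<forall>l\<in>{1..n} - {k}. y < z l)" (is "_ \<longleftrightarrow> ?rhs")
      proof
        assume "unmatched n m \<tau> m U"
        then have sub: "U - {1} \<subseteq> X_all n \<tau>" and Uj: "U \<inter> X_at j \<tau> \<subseteq> {1}"
          and Ul: "\<And>l. l \<in> {1..n} - {j} \<Longrightarrow> U \<inter> X_at l \<tau> = {Min (X_at l \<tau>)}"
          using um by auto
        \<comment> \<open>Otherwise \<open>z j\<close>, which differs from 1, would lie in
          \<open>U \<inter> X_at j \<tau>\<close>, against \<open>Uj\<close>.\<close>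
        have jk: "j = k"
        proof (rule ccontr)
          assume "j \<noteq> k"
          then show False using z_in[OF sub, of j] z_ne_1[of j] zU[of j] j(1) Uj by auto
        qed
        have zMin: "z l = Min (X_at l \<tau>)" "U \<inter> X_at l \<tau> = {z l}" if "l \<in> {1..n} - {k}" for l
        proof -
          have "z l \<in> U \<inter> X_at l \<tau>" using z_in[OF sub that] zU that by blast
          moreover have "U \<inter> X_at l \<tau> = {Min (X_at l \<tau>)}" using Ul that jk by blast
          ultimately show "z l = Min (X_at l \<tau>)" "U \<inter> X_at l \<tau> = {z l}" by auto
        qed
        have "x \<in> z ` {1..n}" if "x \<in> U" for x
        proof (cases "x = 1")
          case True
          then show ?thesis using assms(6,7) by force
        next
          case False
          then obtain l where l: "l \<in> {1..n}" "x \<in> X_at l \<tau>" using sub \<open>x \<in> U\<close> by (auto simp: X_all_def)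
          then have "l \<noteq> k" using Uj jk False \<open>x \<in> U\<close> by auto
          then show ?thesis using zMin(2)[of l] l \<open>x \<in> U\<close> by auto
        qed
        moreover have "z l \<le> x" if "l \<in> {1..n}" "x \<in> X_at l \<tau>" for l x
        proof (cases "l = k")
          case True
          then show ?thesis using subsetD[OF XT[OF that(1)] that(2)] assms(7) by simp
        next
          case False
          then show ?thesis using zMin(1)[of l] Min_le[OF fin that(2)] that(1) by simp
        qed
        moreover have "y < z l" if "l \<in> {1..n} - {k}" for l
        proof -
          have "l \<in> {1..n}" "l \<noteq> j" using that jk by auto
          then have "y \<noteq> z l" using disj[of l j] j z_in[OF sub that] by blast
          moreover have "y \<le> z l" using \<open>l \<in> {1..n}\<close> z_in[OF sub that] by (rule least)
          ultimately show ?thesis by simp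
        qed
        ultimately show ?rhs using sub j jk by blast
      next
        assume ?rhs
        then have sub: "U - {1} \<subseteq> X_all n \<tau>" and Uz: "U \<subseteq> z ` {1..n}"
          and ge: "\<And>l x. l \<in> {1..n} \<Longrightarrow> x \<in> X_at l \<tau> \<Longrightarrow> z l \<le> x" by auto
        from \<open>?rhs\<close> obtain y' where y': "y' \<in> X_at k \<tau>" "\<And>l. l \<in> {1..n} - {k} \<Longrightarrow> y' < z l"
          by blast
        \<comment> \<open>Otherwise (v) and (iii) give \<open>y' < z j\<close> and
          \<open>z j \<le> y\<close>, against the minimality of \<open>y\<close>.\<close>
        have jk: "j = k"
        proof (rule ccontr)
          assume "j \<noteq> k"
          then have "y' < y" using y'(2)[of j] ge[OF j] j(1) by auto
          then show False using least[OF assms(6) y'(1)] by simp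
        qed
        \<comment> \<open>By (ii) an element of \<open>U\<close> is some \<open>z l'\<close>, and
          \<open>z\<close> admits this value only in the value set at \<open>l'\<close>.\<close>
        have own: "x = z l" if "x \<in> U \<inter> X_at l \<tau>" "l \<in> {1..n}" for x l
        proof -
          have "x \<in> z ` {1..n}" using that(1) Uz by blast
          then obtain l' where "l' \<in> {1..n}" "x = z l'" by blast
          with zX[of l' l] that show ?thesis by blast
        qed
        then have "U \<inter> X_at k \<tau> \<subseteq> {1}" using assms(6,7) by fastforce
        moreover have "U \<inter> X_at l \<tau> = {Min (X_at l \<tau>)}" if "l \<in> {1..n} - {k}" for l
        proof -
          have "U \<inter> X_at l \<tau> = {z l}"
            using own that z_in[OF sub that] zU by blast
          moreover have "Min (X_at l \<tau>) = z l"
            using that ge z_in[OF sub that] fin by (intro Min_eqI) auto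
          ultimately show ?thesis by simp
        qed
        ultimately show "unmatched n m \<tau> m U" using um sub jk by blast
      qed
      then show ?thesis using crit i ii v iv by blast
    qed
  qed
qed

end
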